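(* Let $U\subset\mathbb{R}$ be a compact connected set with Lebesgue measure $\mu(U)>0$, let $R=R^T\succ0$ be a real $n\times n$ matrix and let $M$ be a given real $n\times m$ matrix. Consider pairs $(z,w)$ where $z:U\to\mathbb{R}^n$ is integrable over $U$ and $w\in\mathbb{R}^m$ satisfies $\int_U z(s)\,ds=Mw$. Then the following statements are equivalent: 1. The inequality $$-\int_U z(s)^TRz(s)\,ds\le-\mu(U)^{-1}w^TM^TRMw$$ holds for all such pairs $(z,w)$. 2. There exists a real $n\times m$ matrix $N$ such that the inequality $$-\int_U z(s)^TRz(s)\,ds\le w^T\mathcal{Q}(N)w,\qquad \mathcal{Q}(N)=N^TM+M^TN+\mu(U)N^TR^{-1}N,$$ holds for all such pairs $(z,w)$.
   Context: $R\succ0$ means $R$ is positive definite. If $\int_U z(s)^TRz(s)\,ds=+\infty$, the left-hand sides are read as $-\infty$ and the inequalities hold trivially. *)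

theory Defs
  imports "HOL-Analysis.Analysis"
begin

definition quad_form :: "real ^ 'k ^ 'k \<Rightarrow> real ^ 'k \<Rightarrow> real" where
  "quad_form A x = x \<bullet> (A *v x)"

definition pos_def :: "real ^ 'k ^ 'k \<Rightarrow> bool" where
  "pos_def A \<longleftrightarrow> (\<forall>x. x \<noteq> 0 \<longrightarrow> quad_form A x > 0)"

(* The integral of z(s)^T R z(s) over U, possibly infinite.  The conversion to ennreal would
   truncate negative values; it is only used for positive definite R, where there are none. *)
definition energy :: "real set \<Rightarrow> real ^ 'n ^ 'n \<Rightarrow> (real \<Rightarrow> real ^ 'n) \<Rightarrow> ereal" where
  "energy U R z = enn2ereal (\<integral>\<^sup>+s\<in>U. ennreal (quad_form R (z s)) \<partial>lebesgue)"

(* z is a total function, but only its values on U matter.  Integrable means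
   Lebesgue integrable; a real n x m matrix has type real ^ 'm ^ 'n. *)
definition admissible ::
    "real set \<Rightarrow> real ^ 'm ^ 'n \<Rightarrow> (real \<Rightarrow> real ^ 'n) \<Rightarrow> real ^ 'm \<Rightarrow> bool" where
  "admissible U M z w \<longleftrightarrow>
     set_integrable lebesgue U z \<and> (LINT s:U|lebesgue. z s) = M *v w"

definition Q_mat ::
    "real set \<Rightarrow> real ^ 'n ^ 'n \<Rightarrow> real ^ 'm ^ 'n \<Rightarrow> real ^ 'm ^ 'n \<Rightarrow> real ^ 'm ^ 'm" where
  "Q_mat U R M N = transpose N ** M + transpose M ** N
     + measure lebesgue U *\<^sub>R (transpose N ** matrix_inv R ** N)"

end

(* Both conditions hold unconditionally. Let c = M w / \<mu>(U) be the mean of z. Expanding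
   (z - c)^T R (z - c) \<ge> 0 bounds z^T R z below by the affine function 2 z^T R c - c^T R c, and
   integrating this gives condition 1 (Jensen's inequality). For N = - R M / \<mu>(U) the matrix Q(N)
   is - M^T R M / \<mu>(U), so that the inequality in 2 is the one in 1. *)
theory Submission
  imports Defs
begin

text \<open>Conversion to \<open>ennreal\<close> cuts \<open>f\<close> off at zero, and replacing
  \<open>f\<close> by its positive part can only increase the integral. This allows a signed
  minorant of the energy density, with no assumption that the energy is finite.\<close>

lemma ennreal_integral_le_nn_integral:
  fixes f :: "'a \<Rightarrow> real"
  assumes "integrable M f"
  shows "ennreal (integral\<^sup>L M f) \<le> (\<integral>\<^sup>+x. ennreal (f x) \<partial>M)"
proof -
  have int: "integrable M (\<lambda>x. max 0 (f x))"
    using assms by simp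
  have "integral\<^sup>L M f \<le> (LINT x|M. max 0 (f x))"
    by (intro integral_mono assms int) simp
  then have "ennreal (integral\<^sup>L M f) \<le> ennreal (LINT x|M. max 0 (f x))"
    by (rule ennreal_leI)
  also have "\<dots> = (\<integral>\<^sup>+x. ennreal (max 0 (f x)) \<partial>M)"
    by (intro nn_integral_eq_integral[symmetric] int) simp
  also have "\<dots> = (\<integral>\<^sup>+x. ennreal (f x) \<partial>M)"
    by (intro nn_integral_cong) (simp add: max_def ennreal_neg)
  finally show ?thesis .
qed

lemma quad_form_scaleR: "quad_form R (a *\<^sub>R x) = a\<^sup>2 * quad_form R x"
  by (simp add: quad_form_def matrix_vector_mult_scaleR power2_eq_square)

lemma pos_def_quad_form_nonneg: "pos_def R \<Longrightarrow> 0 \<le> quad_form R x"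
  by (cases "x = 0") (auto simp: pos_def_def quad_form_def less_imp_le)

lemma pos_def_invertible:
  fixes R :: "real ^ 'n ^ 'n"
  assumes "pos_def R"
  shows "invertible R"
proof -
  have "x = 0" if "R *v x = 0" for x
    using assms that by (force simp: pos_def_def quad_form_def)
  then show ?thesis
    by (simp add: invertible_left_inverse matrix_left_invertible_ker)
qed

lemma quad_form_congruence:
  fixes R :: "real ^ 'n ^ 'n" and M :: "real ^ 'm ^ 'n"
  shows "quad_form (transpose M ** R ** M) w = quad_form R (M *v w)"
  by (simp add: quad_form_def matrix_vector_mul_assoc[symmetric] transpose_matrix_vector)
    (metis dot_lmul_matrix inner_commute)

lemma quad_form_tangent_le:
  fixes R :: "real ^ 'n ^ 'n"
  assumes "transpose R = R" "pos_def R"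
  shows "2 * (x \<bullet> (R *v c)) - quad_form R c \<le> quad_form R x"
proof -
  \<comment> \<open>By symmetry of \<open>R\<close> the two cross terms in the expansion of
    \<open>quad_form R (x - c)\<close> coincide.\<close>
  have "c \<bullet> (R *v x) = x \<bullet> (R *v c)"
    by (metis assms(1) dot_lmul_matrix inner_commute transpose_matrix_vector)
  moreover have "0 \<le> quad_form R (x - c)"
    by (rule pos_def_quad_form_nonneg[OF assms(2)])
  ultimately show ?thesis
    by (simp add: quad_form_def matrix_vector_mult_diff_distrib inner_diff_left inner_diff_right)
qed

text \<open>The tangent minorant is affine in \<open>z\<close>, so integrability of \<open>z\<close>
  alone makes it integrable over a set of finite measure, even if the energy is infinite.\<close>

lemma jensen_energy:
  fixes R :: "real ^ 'n ^ 'n"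
  assumes U: "U \<in> lmeasurable" "measure lebesgue U > 0"
    and R: "transpose R = R" "pos_def R"
    and z: "set_integrable lebesgue U z"
  shows "ereal (inverse (measure lebesgue U) * quad_form R (LINT s:U|lebesgue. z s))
    \<le> energy U R z"
proof -
  define \<mu> where "\<mu> = measure lebesgue U"
  define I where "I = (LINT s:U|lebesgue. z s)"
  define c where "c = inverse \<mu> *\<^sub>R I"
  \<comment> \<open>The tangent bound at the mean \<open>c\<close>, cut off to vanish outside
    \<open>U\<close>.\<close>
  define g where
    "g s = 2 * ((indicator U s *\<^sub>R z s) \<bullet> (R *v c)) - quad_form R c * indicator U s" for s
  have \<mu>: "\<mu> > 0"
    using U by (simp add: \<mu>_def)
  have intz: "integrable lebesgue (\<lambda>s. indicator U s *\<^sub>R z s)"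
    using z by (simp add: set_integrable_def)
  have intU: "integrable lebesgue (indicator U :: real \<Rightarrow> real)"
    using U(1) by (intro integrable_real_indicator) (auto simp: fmeasurable_def)
  have intg: "integrable lebesgue g"
    unfolding g_def
    by (intro Bochner_Integration.integrable_diff integrable_mult_right integrable_inner_left
        intz intU)
  have "integral\<^sup>L lebesgue g = 2 * (I \<bullet> (R *v c)) - quad_form R c * \<mu>"
    unfolding g_def using integrable_inner_left[OF intz, of "R *v c"] intU
      integral_inner_left[OF intz, of "R *v c"]
    by (subst Bochner_Integration.integral_diff)
      (auto simp: I_def set_lebesgue_integral_def \<mu>_def)
  \<comment> \<open>Since \<open>c\<close> is \<open>I\<close> divided by \<open>\<mu>\<close>, the
    two terms are \<open>2 / \<mu>\<close> and \<open>1 / \<mu>\<close> times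
    \<open>quad_form R I\<close>.\<close>
  also have "\<dots> = inverse \<mu> * quad_form R I"
    using \<mu> by (simp add: c_def quad_form_scaleR power2_eq_square)
      (simp add: quad_form_def matrix_vector_mult_scaleR field_simps)
  finally have int_eq: "integral\<^sup>L lebesgue g = inverse \<mu> * quad_form R I" .
  have "ennreal (integral\<^sup>L lebesgue g) \<le> (\<integral>\<^sup>+s. ennreal (g s) \<partial>lebesgue)"
    by (rule ennreal_integral_le_nn_integral[OF intg])
  also have "\<dots> \<le> (\<integral>\<^sup>+s\<in>U. ennreal (quad_form R (z s)) \<partial>lebesgue)"
    by (intro nn_integral_mono)
      (auto simp: g_def indicator_def intro!: ennreal_leI quad_form_tangent_le[OF R])
  finally have "enn2ereal (ennreal (integral\<^sup>L lebesgue g)) \<le> energy U R z"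
    by (simp add: energy_def less_eq_ennreal.rep_eq)
  \<comment> \<open>Nonnegativity ensures that passing through \<open>ennreal\<close> and back to
    \<open>ereal\<close> leaves this integral unchanged.\<close>
  moreover have "0 \<le> integral\<^sup>L lebesgue g"
    using \<mu> pos_def_quad_form_nonneg[OF R(2), of I] by (simp add: int_eq)
  ultimately show ?thesis
    by (simp add: enn2ereal_ennreal int_eq \<mu>_def I_def)
qed

text \<open>The choice of N comes from completing the square: Q(N) = - M^T R M / \<mu> + \<mu> (N +
  R M / \<mu>)^T R^{-1} (N + R M / \<mu>). The last term is positive semidefinite and vanishes at
  this N.\<close>

lemma quad_form_Q_mat_optimal:
  fixes R :: "real ^ 'n ^ 'n" and M :: "real ^ 'm ^ 'n"
  assumes "measure lebesgue U > 0" and R: "transpose R = R" "pos_def R"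
  shows "quad_form (Q_mat U R M (- inverse (measure lebesgue U) *\<^sub>R (R ** M))) w
    = - (inverse (measure lebesgue U) * quad_form (transpose M ** R ** M) w)"
proof -
  define \<mu> where "\<mu> = measure lebesgue U"
  define a where "a = - inverse \<mu>"
  have a: "\<mu> * a = -1"
    using assms by (simp add: \<mu>_def a_def)
  define N where "N = a *\<^sub>R (R ** M)"
  \<comment> \<open>\<open>matrix_inv\<close> is defined by choice, so its inverse law needs a
    witness, supplied by invertibility of \<open>R\<close>.\<close>
  have "matrix_inv R ** R = mat 1"
    using pos_def_invertible[OF R(2)] unfolding invertible_def matrix_inv_def
    by (rule someI2_ex) blast
  then have 1: "matrix_inv R ** N = a *\<^sub>R M"
    by (simp add: N_def matrix_scalar_ac scalar_matrix_assoc[symmetric] matrix_mul_assoc)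
  have 2: "transpose N = a *\<^sub>R (transpose M ** R)"
    by (simp add: N_def transpose_scalar matrix_transpose_mul R)
  define P where "P = transpose M ** R ** M"
  have "Q_mat U R M N = a *\<^sub>R P + a *\<^sub>R P + \<mu> *\<^sub>R (a *\<^sub>R (a *\<^sub>R P))"
    unfolding Q_mat_def matrix_mul_assoc[symmetric] 1 unfolding 2
    by (simp add: N_def P_def \<mu>_def[symmetric] matrix_scalar_ac
        scalar_matrix_assoc[symmetric] matrix_mul_assoc)
  \<comment> \<open>As \<open>\<mu> * a = -1\<close>, the third summand is
    \<open>- a *\<^sub>R P\<close> and cancels one of the first two.\<close>
  also have "\<dots> = a *\<^sub>R P"
    using a by (simp add: mult.assoc[symmetric])
  finally have "Q_mat U R M N = a *\<^sub>R P" .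
  then have "quad_form (Q_mat U R M N) w = a * quad_form P w"
    by (simp add: quad_form_def scaleR_matrix_vector_assoc[symmetric])
  then show ?thesis
    by (simp add: N_def P_def a_def \<mu>_def)
qed

theorem mainTheorem4:
  fixes U :: "real set" and R :: "real ^ 'n ^ 'n" and M :: "real ^ 'm ^ 'n"
  assumes "compact U" and "connected U" and "measure lebesgue U > 0"
    and "transpose R = R" and "pos_def R"
  shows "(\<forall>z w. admissible U M z w \<longrightarrow>
            - energy U R z \<le>
              ereal (- (inverse (measure lebesgue U) * quad_form (transpose M ** R ** M) w)))
     \<longleftrightarrow> (\<exists>N :: real ^ 'm ^ 'n. \<forall>z w. admissible U M z w \<longrightarrow>
            - energy U R z \<le> ereal (quad_form (Q_mat U R M N) w))"
    (is "?jensen \<longleftrightarrow> ?slack")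
proof -
  have jensen: ?jensen
  proof (intro allI impI)
    fix z w
    assume "admissible U M z w"
    \<comment> \<open>Compactness makes \<open>U\<close> measurable with finite measure, and
      admissibility identifies the integral of \<open>z\<close> with \<open>M *v w\<close>.\<close>
    then have "ereal (inverse (measure lebesgue U) * quad_form R (M *v w)) \<le> energy U R z"
      using jensen_energy[OF lmeasurable_compact[OF assms(1)] assms(3-5), of z]
      by (simp add: admissible_def)
    then show "- energy U R z \<le>
        ereal (- (inverse (measure lebesgue U) * quad_form (transpose M ** R ** M) w))"
      unfolding quad_form_congruence uminus_ereal.simps(1)[symmetric] ereal_minus_le_minus .
  qed
  then have ?slack
    using quad_form_Q_mat_optimal[OF assms(3-5)] by metis
  with jensen show ?thesis
    by blast
qed

end
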